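(* The Tychonoff product of any family of ditopological left unosemigroups (respectively, ditopological right unosemigroups, ditopological unosemigroups) is a ditopological left unosemigroup (respectively, ditopological right unosemigroup, ditopological unosemigroup).
   Context: A topological semigroup is a non-empty topological space $S$ endowed with a continuous associative binary operation $\cdot:S\times S\to S$. A left (resp. right) unit operation on $S$ is a map $\lambda:S\to S$ with $\lambda(x)\cdot x=x$ (resp. a map $\rho:S\to S$ with $x\cdot\rho(x)=x$) for all $x\in S$. For $A,B\subset S$ put $A\leftthreetimes B=\{x\in S: ax\in B \text{ for some } a\in A\}$ and $B\rightthreetimes A=\{x\in S: xa\in B\text{ for some }a\in A\}$. A continuous left unit operation $\lambda$ is dicontinuous if for every $x\in S$ and every neighborhood $O_x\subset S$ of $x$ there are a neighborhood $U_x\subset S$ of $x$ and a neighborhood $W_{\lambda(x)}\subset\lambda(S)$ of $\lambda(x)$ in the subspace $\lambda(S)$ such that $(W_{\lambda(x)}\leftthreetimes U_x)\cap\lambda^{-1}(W_{\lambda(x)})\subset O_x$. A continuous right unit operation $\rho$ is dicontinuous if for every $x\in S$ and every neighborhood $O_x\subset S$ of $x$ there are a neighborhood $U_x\subset S$ of $x$ and a neighborhood $W_{\rho(x)}\subset\rho(S)$ of $\rho(x)$ in the subspace $\rho(S)$ such that $(U_x\rightthreetimes W_{\rho(x)})\cap\rho^{-1}(W_{\rho(x)})\subset O_x$. A ditopological left unosemigroup $(S,\lambda)$ (right unosemigroup $(S,\rho)$, unosemigroup $(S,\lambda,\rho)$) is a topological semigroup $S$ endowed with a dicontinuous left unit operation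 $\lambda$ (a dicontinuous right unit operation $\rho$, both). The Tychonoff product of a family of such structures indexed by $\alpha\in A$ is $S=\prod_{\alpha\in A}S_\alpha$ with the product topology, coordinatewise multiplication, and coordinatewise unit operations $\lambda((x_\alpha)_{\alpha\in A})=(\lambda_\alpha(x_\alpha))_{\alpha\in A}$ and/or $\rho((x_\alpha)_{\alpha\in A})=(\rho_\alpha(x_\alpha))_{\alpha\in A}$. *)

theory Defs
  imports "HOL-Analysis.Analysis"
begin

text \<open>
  A space is a value of type \<open>'a topology\<close> with carrier its \<^const>\<open>topspace\<close>, so that the
  factors of a product may have different carriers. Operations are total functions of which only
  the values on the carrier matter; \<^const>\<open>continuous_map\<close> includes closure of the carrier.
\<close>

definition topological_semigroup :: "'a topology \<Rightarrow> ('a \<Rightarrow> 'a \<Rightarrow> 'a) \<Rightarrow> bool" where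
  "topological_semigroup X m \<longleftrightarrow>
     topspace X \<noteq> {} \<and>
     continuous_map (prod_topology X X) X (\<lambda>(x, y). m x y) \<and>
     (\<forall>x\<in>topspace X. \<forall>y\<in>topspace X. \<forall>z\<in>topspace X. m (m x y) z = m x (m y z))"

definition left_unit_operation :: "'a set \<Rightarrow> ('a \<Rightarrow> 'a \<Rightarrow> 'a) \<Rightarrow> ('a \<Rightarrow> 'a) \<Rightarrow> bool" where
  "left_unit_operation S m l \<longleftrightarrow> l \<in> S \<rightarrow> S \<and> (\<forall>x\<in>S. m (l x) x = x)"

definition right_unit_operation :: "'a set \<Rightarrow> ('a \<Rightarrow> 'a \<Rightarrow> 'a) \<Rightarrow> ('a \<Rightarrow> 'a) \<Rightarrow> bool" where
  "right_unit_operation S m r \<longleftrightarrow> r \<in> S \<rightarrow> S \<and> (\<forall>x\<in>S. m x (r x) = x)"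

definition left_quotient :: "'a set \<Rightarrow> ('a \<Rightarrow> 'a \<Rightarrow> 'a) \<Rightarrow> 'a set \<Rightarrow> 'a set \<Rightarrow> 'a set" where
  "left_quotient S m A B = {x \<in> S. \<exists>a\<in>A. m a x \<in> B}"

text \<open>The set being divided comes first here, the divisor second.\<close>

definition right_quotient :: "'a set \<Rightarrow> ('a \<Rightarrow> 'a \<Rightarrow> 'a) \<Rightarrow> 'a set \<Rightarrow> 'a set \<Rightarrow> 'a set" where
  "right_quotient S m B A = {x \<in> S. \<exists>a\<in>A. m x a \<in> B}"

text \<open>Neighborhoods are not required to be open.\<close>

definition neighborhood_in :: "'a topology \<Rightarrow> 'a \<Rightarrow> 'a set \<Rightarrow> bool" where
  "neighborhood_in X x N \<longleftrightarrow> N \<subseteq> topspace X \<and> x \<in> X interior_of N"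

definition dicontinuous_left ::
    "'a topology \<Rightarrow> ('a \<Rightarrow> 'a \<Rightarrow> 'a) \<Rightarrow> ('a \<Rightarrow> 'a) \<Rightarrow> bool" where
  "dicontinuous_left X m l \<longleftrightarrow>
     continuous_map X X l \<and>
     (\<forall>x\<in>topspace X. \<forall>O\<^sub>x. neighborhood_in X x O\<^sub>x \<longrightarrow>
       (\<exists>U W. neighborhood_in X x U \<and>
              neighborhood_in (subtopology X (l ` topspace X)) (l x) W \<and>
              left_quotient (topspace X) m W U \<inter> {y \<in> topspace X. l y \<in> W} \<subseteq> O\<^sub>x))"

definition dicontinuous_right ::
    "'a topology \<Rightarrow> ('a \<Rightarrow> 'a \<Rightarrow> 'a) \<Rightarrow> ('a \<Rightarrow> 'a) \<Rightarrow> bool" where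
  "dicontinuous_right X m r \<longleftrightarrow>
     continuous_map X X r \<and>
     (\<forall>x\<in>topspace X. \<forall>O\<^sub>x. neighborhood_in X x O\<^sub>x \<longrightarrow>
       (\<exists>U W. neighborhood_in X x U \<and>
              neighborhood_in (subtopology X (r ` topspace X)) (r x) W \<and>
              right_quotient (topspace X) m U W \<inter> {y \<in> topspace X. r y \<in> W} \<subseteq> O\<^sub>x))"

definition ditopological_left_unosemigroup ::
    "'a topology \<Rightarrow> ('a \<Rightarrow> 'a \<Rightarrow> 'a) \<Rightarrow> ('a \<Rightarrow> 'a) \<Rightarrow> bool" where
  "ditopological_left_unosemigroup X m l \<longleftrightarrow>
     topological_semigroup X m \<and> left_unit_operation (topspace X) m l \<and> dicontinuous_left X m l"

definition ditopological_right_unosemigroup ::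
    "'a topology \<Rightarrow> ('a \<Rightarrow> 'a \<Rightarrow> 'a) \<Rightarrow> ('a \<Rightarrow> 'a) \<Rightarrow> bool" where
  "ditopological_right_unosemigroup X m r \<longleftrightarrow>
     topological_semigroup X m \<and> right_unit_operation (topspace X) m r \<and> dicontinuous_right X m r"

definition ditopological_unosemigroup ::
    "'a topology \<Rightarrow> ('a \<Rightarrow> 'a \<Rightarrow> 'a) \<Rightarrow> ('a \<Rightarrow> 'a) \<Rightarrow> ('a \<Rightarrow> 'a) \<Rightarrow> bool" where
  "ditopological_unosemigroup X m l r \<longleftrightarrow>
     topological_semigroup X m \<and>
     left_unit_operation (topspace X) m l \<and> dicontinuous_left X m l \<and>
     right_unit_operation (topspace X) m r \<and> dicontinuous_right X m r"

text \<open>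
  The carrier of \<^term>\<open>product_topology X I\<close> consists of functions that are \<^const>\<open>undefined\<close>
  outside \<open>I\<close>; hence the restrictions to \<open>I\<close>.
\<close>

definition product_mult ::
    "'i set \<Rightarrow> ('i \<Rightarrow> 'a \<Rightarrow> 'a \<Rightarrow> 'a) \<Rightarrow> ('i \<Rightarrow> 'a) \<Rightarrow> ('i \<Rightarrow> 'a) \<Rightarrow> 'i \<Rightarrow> 'a" where
  "product_mult I m x y = (\<lambda>i\<in>I. m i (x i) (y i))"

definition product_unit ::
    "'i set \<Rightarrow> ('i \<Rightarrow> 'a \<Rightarrow> 'a) \<Rightarrow> ('i \<Rightarrow> 'a) \<Rightarrow> 'i \<Rightarrow> 'a" where
  "product_unit I u x = (\<lambda>i\<in>I. u i (x i))"

end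

theory Submission
  imports Defs
begin

text \<open>
  Shrink a given neighborhood of \<open>x\<close> to a basic box. In the finitely many coordinates where the
  box is constrained, use dicontinuity of the factor; elsewhere take the whole factor. The
  resulting boxes witness dicontinuity of the product. The right-handed case is the left-handed
  one for the opposite multiplication.
\<close>

text \<open>Every neighborhood contains an open one, and a relatively open subset of the image of
  \<open>l\<close> is the trace of an open \<open>T\<close> of \<open>X\<close>. Points of the trace
  have the form \<open>l z\<close>, so quantifying over \<open>z\<close> replaces the divisor. In
  this form the subspace topology on the image disappears and need not be identified for a
  product.\<close>

lemma dicontinuous_left_iff_open:
  "dicontinuous_left X m l \<longleftrightarrow>
     continuous_map X X l \<and>
     (\<forall>x\<in>topspace X. \<forall>V. openin X V \<and> x \<in> V \<longrightarrow>
       (\<exists>U T. openin X U \<and> openin X T \<and> x \<in> U \<and> l x \<in> T \<and>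
          (\<forall>z\<in>topspace X. \<forall>y\<in>topspace X.
             l z \<in> T \<and> m (l z) y \<in> U \<and> l y \<in> T \<longrightarrow> y \<in> V)))"
    (is "?L \<longleftrightarrow> ?C \<and> ?R")
proof
  assume L: ?L
  then have C: ?C by (simp add: dicontinuous_left_def)
  have ?R
  proof (intro ballI allI impI)
    fix x V assume x: "x \<in> topspace X" and V: "openin X V \<and> x \<in> V"
    then have "neighborhood_in X x V"
      by (simp add: neighborhood_in_def interior_of_openin openin_subset)
    then obtain U W where U: "neighborhood_in X x U"
      and W: "neighborhood_in (subtopology X (l ` topspace X)) (l x) W"
      and sub: "left_quotient (topspace X) m W U \<inter> {y \<in> topspace X. l y \<in> W} \<subseteq> V"
      using L x unfolding dicontinuous_left_def by meson
    obtain T where T: "openin X T" "l x \<in> T" "T \<inter> l ` topspace X \<subseteq> W"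
      using W unfolding neighborhood_in_def interior_of_def openin_subtopology by auto
    obtain U' where U': "openin X U'" "x \<in> U'" "U' \<subseteq> U"
      using U unfolding neighborhood_in_def interior_of_def by auto
    \<comment> \<open>\<open>T\<close> may stick out of \<open>W\<close>, but only values of
      \<open>l\<close> are tested, and those lying in \<open>T\<close> lie in
      \<open>W\<close>.\<close>
    have "y \<in> V" if "z \<in> topspace X" "y \<in> topspace X" "l z \<in> T" "m (l z) y \<in> U'" "l y \<in> T" for z y
    proof -
      have "l z \<in> W" "l y \<in> W" using that T by auto
      then show ?thesis using that U' sub unfolding left_quotient_def by blast
    qed
    then show "\<exists>U T. openin X U \<and> openin X T \<and> x \<in> U \<and> l x \<in> T \<and>
          (\<forall>z\<in>topspace X. \<forall>y\<in>topspace X.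
             l z \<in> T \<and> m (l z) y \<in> U \<and> l y \<in> T \<longrightarrow> y \<in> V)"
      using T U' by blast
  qed
  with C show "?C \<and> ?R" by (rule conjI)
next
  assume CR: "?C \<and> ?R"
  show ?L
    unfolding dicontinuous_left_def
  proof (intro conjI ballI allI impI)
    show ?C using CR by (rule conjunct1)
    fix x N assume x: "x \<in> topspace X" and N: "neighborhood_in X x N"
    then obtain V where V: "openin X V" "x \<in> V" "V \<subseteq> N"
      unfolding neighborhood_in_def interior_of_def by auto
    obtain U T where U: "openin X U" "x \<in> U" and T: "openin X T" "l x \<in> T"
      and sub: "\<forall>z\<in>topspace X. \<forall>y\<in>topspace X.
             l z \<in> T \<and> m (l z) y \<in> U \<and> l y \<in> T \<longrightarrow> y \<in> V"
      using mp[OF spec[OF bspec[OF conjunct2[OF CR] x]] conjI[OF V(1,2)]]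
      by (elim exE conjE) (rule that)
    \<comment> \<open>Conversely, cutting \<open>T\<close> down to the image loses nothing: each
      divisor taken from \<open>?W\<close> is some \<open>l z\<close> with \<open>z\<close> in the
      carrier, as \<open>sub\<close> requires.\<close>
    let ?W = "T \<inter> l ` topspace X"
    have "openin (subtopology X (l ` topspace X)) ?W"
      using T(1) by (rule openin_subtopology_Int)
    then have "neighborhood_in (subtopology X (l ` topspace X)) (l x) ?W"
      using T x openin_subset[OF T(1)] unfolding neighborhood_in_def
      by (simp add: interior_of_openin le_infI1)
    moreover have "neighborhood_in X x U"
      using U by (simp add: neighborhood_in_def interior_of_openin openin_subset)
    moreover have "left_quotient (topspace X) m ?W U \<inter> {y \<in> topspace X. l y \<in> ?W} \<subseteq> N"
      using sub V(3) by (auto simp: left_quotient_def)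
    ultimately show "\<exists>U W. neighborhood_in X x U \<and>
              neighborhood_in (subtopology X (l ` topspace X)) (l x) W \<and>
              left_quotient (topspace X) m W U \<inter> {y \<in> topspace X. l y \<in> W} \<subseteq> N"
      by (intro exI[of _ U] exI[of _ ?W]) simp
  qed
qed

lemma continuous_map_product_unit:
  assumes "\<And>i. i \<in> I \<Longrightarrow> continuous_map (X i) (X i) (u i)"
  shows "continuous_map (product_topology X I) (product_topology X I) (product_unit I u)"
  unfolding continuous_map_componentwise
proof (intro conjI ballI)
  show "product_unit I u ` topspace (product_topology X I) \<subseteq> extensional I"
    by (auto simp: product_unit_def)
  fix i assume i: "i \<in> I"
  have "continuous_map (product_topology X I) (X i) (u i \<circ> (\<lambda>x. x i))"
    using assms[OF i] continuous_map_product_projection[OF i]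
    by (rule continuous_map_compose[rotated])
  then show "continuous_map (product_topology X I) (X i) (\<lambda>x. product_unit I u x i)"
    using i by (simp add: product_unit_def o_def)
qed

lemma topological_semigroup_product:
  assumes ts: "\<And>i. i \<in> I \<Longrightarrow> topological_semigroup (X i) (m i)"
  shows "topological_semigroup (product_topology X I) (product_mult I m)"
  unfolding topological_semigroup_def
proof (intro conjI ballI)
  let ?P = "product_topology X I"
  show "topspace ?P \<noteq> {}"
    \<comment> \<open>A product of nonempty sets is nonempty; for empty \<open>I\<close> it is a
      single point.\<close>
    using ts by (simp add: topological_semigroup_def PiE_eq_empty_iff)
  show "continuous_map (prod_topology ?P ?P) ?P (\<lambda>(x, y). product_mult I m x y)"
    unfolding continuous_map_componentwise
  proof (intro conjI ballI)
    show "(\<lambda>(x, y). product_mult I m x y) ` topspace (prod_topology ?P ?P) \<subseteq> extensional I"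
      by (auto simp: product_mult_def)
    fix i assume i: "i \<in> I"
    note proj = continuous_map_product_projection[OF i, of X]
    \<comment> \<open>The \<open>i\<close>-th coordinate of a product of two points depends only on
      their \<open>i\<close>-th coordinates, so it is \<open>m i\<close> composed with this pair of
      projections.\<close>
    have "continuous_map (prod_topology ?P ?P) (prod_topology (X i) (X i))
            (\<lambda>p. (fst p i, snd p i))"
      using continuous_map_compose[OF continuous_map_fst[of ?P ?P] proj]
        continuous_map_compose[OF continuous_map_snd[of ?P ?P] proj]
      by (simp add: continuous_map_paired o_def)
    moreover have "continuous_map (prod_topology (X i) (X i)) (X i) (\<lambda>(x, y). m i x y)"
      using ts[OF i] by (simp add: topological_semigroup_def)
    ultimately have "continuous_map (prod_topology ?P ?P) (X i)
        ((\<lambda>(x, y). m i x y) \<circ> (\<lambda>p. (fst p i, snd p i)))"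
      by (rule continuous_map_compose)
    then show "continuous_map (prod_topology ?P ?P) (X i)
        (\<lambda>p. (case p of (x, y) \<Rightarrow> product_mult I m x y) i)"
      using i by (simp add: product_mult_def o_def case_prod_unfold)
  qed
  fix x y z assume "x \<in> topspace ?P" "y \<in> topspace ?P" "z \<in> topspace ?P"
  then show "product_mult I m (product_mult I m x y) z = product_mult I m x (product_mult I m y z)"
    using ts by (auto simp: product_mult_def topological_semigroup_def PiE_iff intro!: restrict_ext)
qed

text \<open>The unit law involves no topology, so bare carriers \<open>S i\<close> suffice. It holds
  in each coordinate, and extensionality settles the arguments outside \<open>I\<close>.\<close>

lemma left_unit_operation_product:
  assumes "\<And>i. i \<in> I \<Longrightarrow> left_unit_operation (S i) (m i) (l i)"
  shows "left_unit_operation (Pi\<^sub>E I S) (product_mult I m) (product_unit I l)"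
  unfolding left_unit_operation_def
proof (intro conjI ballI)
  show "product_unit I l \<in> Pi\<^sub>E I S \<rightarrow> Pi\<^sub>E I S"
    using assms by (fastforce simp: product_unit_def left_unit_operation_def PiE_iff Pi_iff)
  fix x assume "x \<in> Pi\<^sub>E I S"
  then show "product_mult I m (product_unit I l x) x = x"
    using assms by (intro extensionalityI[of _ I])
      (auto simp: product_mult_def product_unit_def left_unit_operation_def PiE_iff)
qed

lemma dicontinuous_left_product:
  assumes dc: "\<And>i. i \<in> I \<Longrightarrow> dicontinuous_left (X i) (m i) (l i)"
  shows "dicontinuous_left (product_topology X I) (product_mult I m) (product_unit I l)"
  unfolding dicontinuous_left_iff_open
proof (intro conjI ballI allI impI)
  let ?P = "product_topology X I"
  have cont: "\<And>i. i \<in> I \<Longrightarrow> continuous_map (X i) (X i) (l i)"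
    using dc by (simp add: dicontinuous_left_def)
  then show "continuous_map ?P ?P (product_unit I l)"
    by (rule continuous_map_product_unit)
  fix x V assume x: "x \<in> topspace ?P" and V: "openin ?P V \<and> x \<in> V"
  then obtain B where fin: "finite {i \<in> I. B i \<noteq> topspace (X i)}"
    and B: "\<And>i. i \<in> I \<Longrightarrow> openin (X i) (B i)" and xB: "x \<in> Pi\<^sub>E I B" and BV: "Pi\<^sub>E I B \<subseteq> V"
    unfolding openin_product_topology_alt by meson
  \<comment> \<open>The last clause keeps the choice trivial wherever the box \<open>B\<close> is
    unconstrained. Dicontinuity alone could return proper open subsets at infinitely many
    coordinates, and the boxes built from them need not be open.\<close>
  have "\<exists>U T. openin (X i) U \<and> openin (X i) T \<and> x i \<in> U \<and> l i (x i) \<in> T \<and>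
          (\<forall>z\<in>topspace (X i). \<forall>y\<in>topspace (X i).
             l i z \<in> T \<and> m i (l i z) y \<in> U \<and> l i y \<in> T \<longrightarrow> y \<in> B i) \<and>
          (B i = topspace (X i) \<longrightarrow> U = topspace (X i) \<and> T = topspace (X i))"
    if i: "i \<in> I" for i
  proof (cases "B i = topspace (X i)")
    case True
    have "x i \<in> topspace (X i)" using x i by auto
    \<comment> \<open>Continuity of \<open>l i\<close> includes closure of the carrier, so the whole
      carrier is admissible as \<open>T\<close>.\<close>
    moreover from this have "l i (x i) \<in> topspace (X i)"
      using cont[OF i] by (auto dest: continuous_map_funspace)
    ultimately show ?thesis
      by (intro exI[of _ "topspace (X i)"]) (simp add: True)
  next
    case False
    have "x i \<in> topspace (X i)" "x i \<in> B i" using x xB i by auto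
    then have "\<exists>U T. openin (X i) U \<and> openin (X i) T \<and> x i \<in> U \<and> l i (x i) \<in> T \<and>
          (\<forall>z\<in>topspace (X i). \<forall>y\<in>topspace (X i).
             l i z \<in> T \<and> m i (l i z) y \<in> U \<and> l i y \<in> T \<longrightarrow> y \<in> B i)"
      using dc[OF i] B[OF i] unfolding dicontinuous_left_iff_open by simp
    with False show ?thesis by simp
  qed
  then obtain U T where
    UT: "\<And>i. i \<in> I \<Longrightarrow> openin (X i) (U i) \<and> openin (X i) (T i) \<and> x i \<in> U i \<and> l i (x i) \<in> T i"
    and sub: "\<And>i z y. \<lbrakk>i \<in> I; z \<in> topspace (X i); y \<in> topspace (X i);
        l i z \<in> T i; m i (l i z) y \<in> U i; l i y \<in> T i\<rbrakk> \<Longrightarrow> y \<in> B i"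
    and triv: "\<And>i. i \<in> I \<Longrightarrow> B i = topspace (X i) \<Longrightarrow> U i = topspace (X i) \<and> T i = topspace (X i)"
    by metis
  \<comment> \<open>By \<open>triv\<close>, the coordinates constrained in \<open>U\<close> or in
    \<open>T\<close> are among the finitely many constrained in \<open>B\<close>; this makes both
    boxes open.\<close>
  have "finite {i \<in> I. U i \<noteq> topspace (X i)}" "finite {i \<in> I. T i \<noteq> topspace (X i)}"
    by (rule finite_subset[OF _ fin], use triv in blast)+
  then have "openin ?P (Pi\<^sub>E I U)" "openin ?P (Pi\<^sub>E I T)"
    using UT by (auto simp: openin_PiE_gen)
  moreover have "x \<in> Pi\<^sub>E I U" "product_unit I l x \<in> Pi\<^sub>E I T"
    using UT x by (auto simp: product_unit_def PiE_iff)
  moreover have "y \<in> V"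
    if z: "z \<in> topspace ?P" and y: "y \<in> topspace ?P"
      and zT: "product_unit I l z \<in> Pi\<^sub>E I T"
      and zyU: "product_mult I m (product_unit I l z) y \<in> Pi\<^sub>E I U"
      and yT: "product_unit I l y \<in> Pi\<^sub>E I T" for z y
  proof -
    have "y i \<in> B i" if i: "i \<in> I" for i
    \<comment> \<open>The \<open>i\<close>-th coordinate of \<open>product_unit I l z\<close> is
      \<open>l i (z i)\<close>, so \<open>z i\<close> is the witness in the factor.\<close>
    proof (rule sub[OF i, of "z i"])
      show "z i \<in> topspace (X i)" "y i \<in> topspace (X i)" using z y i by auto
      show "l i (z i) \<in> T i" "l i (y i) \<in> T i"
        using PiE_mem[OF zT i] PiE_mem[OF yT i] i by (simp_all add: product_unit_def)
      show "m i (l i (z i)) (y i) \<in> U i"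
        using PiE_mem[OF zyU i] i by (simp add: product_unit_def product_mult_def)
    qed
    then have "y \<in> Pi\<^sub>E I B" using y by (auto simp: PiE_iff)
    then show ?thesis using BV by blast
  qed
  ultimately show "\<exists>U T. openin ?P U \<and> openin ?P T \<and> x \<in> U \<and> product_unit I l x \<in> T \<and>
      (\<forall>z\<in>topspace ?P. \<forall>y\<in>topspace ?P.
         product_unit I l z \<in> T \<and> product_mult I m (product_unit I l z) y \<in> U \<and>
         product_unit I l y \<in> T \<longrightarrow> y \<in> V)"
    by (intro exI[of _ "Pi\<^sub>E I U"] exI[of _ "Pi\<^sub>E I T"]) simp
qed

lemma right_unit_operation_opposite:
  "right_unit_operation S m r \<longleftrightarrow> left_unit_operation S (\<lambda>x y. m y x) r"
  by (simp add: right_unit_operation_def left_unit_operation_def)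

text \<open>Reversing the multiplication exchanges the two quotients, up to the order of their set
  arguments, and leaves the topology and the unit operation unchanged.\<close>

lemma dicontinuous_right_opposite:
  "dicontinuous_right X m r \<longleftrightarrow> dicontinuous_left X (\<lambda>x y. m y x) r"
  by (simp add: dicontinuous_right_def dicontinuous_left_def right_quotient_def left_quotient_def)

text \<open>Forming opposites commutes with products, so the right-handed product results become
  instances of the left-handed ones.\<close>

lemma product_mult_opposite:
  "(\<lambda>x y. product_mult I m y x) = product_mult I (\<lambda>i x y. m i y x)"
  by (simp add: product_mult_def fun_eq_iff)

lemma right_unit_operation_product:
  assumes "\<And>i. i \<in> I \<Longrightarrow> right_unit_operation (S i) (m i) (r i)"
  shows "right_unit_operation (Pi\<^sub>E I S) (product_mult I m) (product_unit I r)"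
  using assms unfolding right_unit_operation_opposite product_mult_opposite
  by (rule left_unit_operation_product)

lemma dicontinuous_right_product:
  assumes "\<And>i. i \<in> I \<Longrightarrow> dicontinuous_right (X i) (m i) (r i)"
  shows "dicontinuous_right (product_topology X I) (product_mult I m) (product_unit I r)"
  \<comment> \<open>Both the hypothesis and the goal turn into left-handed statements about the
    multiplications \<open>\<lambda>x y. m i y x\<close>.\<close>
  using assms unfolding dicontinuous_right_opposite product_mult_opposite
  by (rule dicontinuous_left_product)

theorem proposition5:
  fixes I :: "'i set"
    and X :: "'i \<Rightarrow> 'a topology"
    and m :: "'i \<Rightarrow> 'a \<Rightarrow> 'a \<Rightarrow> 'a"
    and l r :: "'i \<Rightarrow> 'a \<Rightarrow> 'a"
  shows
    "((\<forall>i\<in>I. ditopological_left_unosemigroup (X i) (m i) (l i)) \<longrightarrow>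
        ditopological_left_unosemigroup
          (product_topology X I) (product_mult I m) (product_unit I l)) \<and>
     ((\<forall>i\<in>I. ditopological_right_unosemigroup (X i) (m i) (r i)) \<longrightarrow>
        ditopological_right_unosemigroup
          (product_topology X I) (product_mult I m) (product_unit I r)) \<and>
     ((\<forall>i\<in>I. ditopological_unosemigroup (X i) (m i) (l i) (r i)) \<longrightarrow>
        ditopological_unosemigroup
          (product_topology X I) (product_mult I m) (product_unit I l) (product_unit I r))"
  \<comment> \<open>Each structure is a conjunction of properties already shown to pass to products;
    the carrier of the product unfolds to the \<open>Pi\<^sub>E\<close> of the carriers, which is
    where the unit laws were stated.\<close>
  by (simp add: ditopological_left_unosemigroup_def ditopological_right_unosemigroup_def
      ditopological_unosemigroup_def topological_semigroup_product
      left_unit_operation_product right_unit_operation_product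
      dicontinuous_left_product dicontinuous_right_product)

end
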